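(* Let $\Pi$ be a graph property, and let $Q:(0,1)\to\mathbb{N}$. Then the following hold. (i) If $\Pi$ admits a size-oblivious one-sided-error tester with query complexity at most $Q(\varepsilon)$, then $\Pi$ has a semi-hereditary witness $(\mathcal{H},M)$ satisfying $M(\varepsilon)=O(Q(c\varepsilon))$ for an absolute constant $c>0$, and for every $\varepsilon$ the property $\mathcal{H}$ admits an $(\varepsilon,\eta(\varepsilon),N(\varepsilon),q(\varepsilon))$-ordered container lemma with $$q(\varepsilon)=O(Q(c\varepsilon)),\qquad \eta(\varepsilon)=\Omega(Q(c\varepsilon)^{-1}),\qquad N(\varepsilon)=O(Q(c\varepsilon)).$$ (ii) Conversely, if $\Pi$ has a semi-hereditary witness $(\mathcal{H},M)$ and, for every $\varepsilon$, $\mathcal{H}$ admits an $(\varepsilon,\eta(\varepsilon),N(\varepsilon),q(\varepsilon))$-ordered container lemma, then $\Pi$ admits a size-oblivious one-sided-error tester with query complexity $$O\!\left(M(\varepsilon/2)^2\right)+\widetilde O\!\left(N(\varepsilon/2)^2+\frac{(q(\varepsilon/2)+1)^2}{\eta(\varepsilon/2)^2}\right).$$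
   Context: A graph is a finite simple labelled graph (no loops, no multiple edges). A graph property is a family of graphs closed under isomorphism; it is hereditary if it is closed under taking induced subgraphs. Distance: for graphs $G,G'$ on the same $n$-element vertex set, $\mathrm{dist}(G,G')=|E(G)\triangle E(G')|/n^2$, and $\mathrm{dist}(G,\Pi)$ is the minimum of $\mathrm{dist}(G,G')$ over $G'\in\Pi$ with $V(G')=V(G)$ (the minimum over the empty set being $+\infty$). $G$ is $\varepsilon$-far from $\Pi$ if $\mathrm{dist}(G,\Pi)>\varepsilon$, and $\varepsilon$-close otherwise. Semi-hereditary witness: a pair $(\mathcal{H},M)$ where $\mathcal{H}\supseteq\Pi$ is a hereditary graph property and $M:(0,1)\to\mathbb{N}$ is such that, for every $\varepsilon>0$, every graph $G\in\mathcal{H}$ with at least $M(\varepsilon)$ vertices is $\varepsilon$-close to $\Pi$. Tester: a size-oblivious tester for $\Pi$ is a randomized oracle algorithm which, given $\varepsilon>0$ but not $|V(G)|$, has oracle access to the adjacency predicate of $G$ and to independent uniform samples from $V(G)$, accepts every $G\in\Pi$ with probability at least $2/3$, and rejects every $G$ that is $\varepsilon$-far from $\Pi$ with probability at least $2/3$. Its query complexity is the maximum number of adjacency queries it makes and its sample complexity is the maximum number of vertex labels it inspects; both must be bounded in terms of $\varepsilon$ only. It has one-sided error if it accepts every graph in $\Pi$ with probability one. Complexity bounds are tacitly replaced by their nonincreasing monotone closures in $\varepsilon$. A canonical tester samples a uniformly random vertex set $S$ of a prescribed size (depending only on $\varepsilon$), queries every pair in $S$, and decides from the isomorphism type of $G[S]$;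 if the prescribed size exceeds $|V(G)|$, it inspects the whole graph. Standing convention (canonicalization theorem of Goldreich and Trevisan): a size-oblivious tester making at most $Q(\varepsilon)$ adjacency queries is taken to be convertible, preserving one-sidedness and after changing $\varepsilon$ by an absolute constant factor, into a canonical tester sampling $O(Q(\varepsilon))$ vertices. Ordered container lemma: for a set $V$, $V_{\neq}^{j}$ denotes the ordered $j$-tuples of distinct elements of $V$, and $\binom{V}{\le x}$ the subsets of $V$ of size at most $x$. For a hereditary graph property $\mathcal{H}$, $\varepsilon,\eta>0$ and integers $N,q\ge0$, $\mathcal{H}$ admits an $(\varepsilon,\eta,N,q)$-ordered container lemma if for every $n\ge N$ and every $n$-vertex graph $G=(V,E)$ that is $\varepsilon$-far from $\mathcal{H}$ there exist maps $$f:\{U\subseteq V:G[U]\in\mathcal{H}\}\to\bigcup_{j=0}^{q}V_{\neq}^{j},\qquad C:\operatorname{im}(f)\to\binom{V}{\le(1-\eta)n},$$ such that every entry of $f(U)$ belongs to $U$ and $U\subseteq C(f(U))$ whenever $G[U]\in\mathcal{H}$. $\widetilde O(\cdot)$ hides polylogarithmic factors in the displayed quantities. Implied constants are absolute. *)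

theory Defs
  imports "HOL-Probability.Probability"
begin

subsection \<open>Labelled graphs and graph properties\<close>

text \<open>A pair of a vertex set and an edge set. The vertex set is an arbitrary finite set of
  labels, not necessarily an initial segment of the naturals, so that labels carry no information
  about the number of vertices. The graph without vertices is admitted.\<close>

type_synonym graph = "nat set \<times> nat set set"

abbreviation verts :: "graph \<Rightarrow> nat set" where "verts G \<equiv> fst G"
abbreviation edges :: "graph \<Rightarrow> nat set set" where "edges G \<equiv> snd G"

definition is_graph :: "graph \<Rightarrow> bool" where
  "is_graph G \<longleftrightarrow> finite (verts G) \<and> edges G \<subseteq> {e. e \<subseteq> verts G \<and> card e = 2}"

definition iso :: "graph \<Rightarrow> graph \<Rightarrow> bool" where
  "iso G G' \<longleftrightarrow> (\<exists>h. bij_betw h (verts G) (verts G') \<and> edges G' = (\<lambda>e. h ` e) ` edges G)"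

definition induced :: "graph \<Rightarrow> nat set \<Rightarrow> graph" where
  "induced G U = (U, {e \<in> edges G. e \<subseteq> U})"

definition graph_property :: "graph set \<Rightarrow> bool" where
  "graph_property P \<longleftrightarrow>
     (\<forall>G\<in>P. is_graph G) \<and> (\<forall>G\<in>P. \<forall>G'. is_graph G' \<longrightarrow> iso G G' \<longrightarrow> G' \<in> P)"

definition hereditary :: "graph set \<Rightarrow> bool" where
  "hereditary P \<longleftrightarrow> graph_property P \<and> (\<forall>G\<in>P. \<forall>U\<subseteq>verts G. induced G U \<in> P)"

subsection \<open>Distance\<close>

definition graph_dist :: "graph \<Rightarrow> graph \<Rightarrow> real" where
  "graph_dist G G' = real (card (sym_diff (edges G) (edges G'))) / (real (card (verts G)))\<^sup>2"

text \<open>Only finitely many graphs live on a given vertex set, so the infimum is a minimum;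
  over the empty set it is \<open>\<infinity>\<close>.\<close>

definition dist_to :: "graph \<Rightarrow> graph set \<Rightarrow> ereal" where
  "dist_to G P = (INF G' \<in> {G' \<in> P. verts G' = verts G}. ereal (graph_dist G G'))"

definition far :: "real \<Rightarrow> graph \<Rightarrow> graph set \<Rightarrow> bool" where
  "far \<epsilon> G P \<longleftrightarrow> dist_to G P > ereal \<epsilon>"

definition semi_hereditary_witness :: "graph set \<Rightarrow> graph set \<Rightarrow> (real \<Rightarrow> nat) \<Rightarrow> bool" where
  "semi_hereditary_witness P H M \<longleftrightarrow> hereditary H \<and> P \<subseteq> H \<and>
     (\<forall>\<epsilon>\<in>{0<..<1}. \<forall>G\<in>H. card (verts G) \<ge> M \<epsilon> \<longrightarrow> \<not> far \<epsilon> G P)"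

subsection \<open>Ordered container lemma\<close>

definition ordered_container :: "graph set \<Rightarrow> real \<Rightarrow> real \<Rightarrow> nat \<Rightarrow> nat \<Rightarrow> bool" where
  "ordered_container H \<epsilon> \<eta> N q \<longleftrightarrow> 0 < \<epsilon> \<and> 0 < \<eta> \<and>
     (\<forall>G. is_graph G \<longrightarrow> card (verts G) \<ge> N \<longrightarrow> far \<epsilon> G H \<longrightarrow>
       (\<exists>(f :: nat set \<Rightarrow> nat list) (C :: nat list \<Rightarrow> nat set).
          \<forall>U \<subseteq> verts G. induced G U \<in> H \<longrightarrow>
            distinct (f U) \<and> length (f U) \<le> q \<and> set (f U) \<subseteq> U \<and>
            C (f U) \<subseteq> verts G \<and>
            real (card (C (f U))) \<le> (1 - \<eta>) * real (card (verts G)) \<and>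
            U \<subseteq> C (f U)))"

subsection \<open>Randomized oracle algorithms\<close>

text \<open>Algorithms are decision trees. \<open>Toss\<close> is internal randomness. \<open>Query u v\<close> asks the adjacency
  oracle. \<open>Sample m\<close> draws, independently of everything before, a uniformly random set of \<open>m\<close>
  vertices, or the whole vertex set if there are fewer than \<open>m\<close>. Thus \<open>Sample 1\<close> is one independent
  uniform vertex, and general \<open>m\<close> is the sampling step of a canonical tester. The number of
  vertices is never given to the algorithm.

  The case of large \<open>m\<close> matters: with single independent samples alone, every execution on an
  induced subgraph is also a possible execution on the whole graph, so no one-sided tester could
  treat small graphs separately (as for triangle-free graphs on at least ten vertices).\<close>

datatype alg =
    Decide bool
  | Toss "nat pmf" "nat \<Rightarrow> alg"
  | Sample nat "nat set \<Rightarrow> alg"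
  | Query nat nat "bool \<Rightarrow> alg"

definition random_subset :: "graph \<Rightarrow> nat \<Rightarrow> nat set pmf" where
  "random_subset G m = pmf_of_set {S. S \<subseteq> verts G \<and> card S = min m (card (verts G))}"

text \<open>The outcome of an execution: the verdict (\<open>True\<close> is acceptance), the number of adjacency
  queries made, and the number of vertex labels received.\<close>

type_synonym outcome = "bool \<times> nat \<times> nat"

primrec run :: "graph \<Rightarrow> alg \<Rightarrow> outcome pmf" where
  "run G (Decide b) = return_pmf (b, 0, 0)"
| "run G (Toss p k) = bind_pmf p (\<lambda>x. run G (k x))"
| "run G (Sample m k) = bind_pmf (random_subset G m)
     (\<lambda>S. map_pmf (\<lambda>(b, q, s). (b, q, s + card S)) (run G (k S)))"
| "run G (Query u v k) = map_pmf (\<lambda>(b, q, s). (b, Suc q, s)) (run G (k ({u, v} \<in> edges G)))"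

definition accept_prob :: "graph \<Rightarrow> alg \<Rightarrow> real" where
  "accept_prob G A = measure_pmf.prob (run G A) {r. fst r}"

definition reject_prob :: "graph \<Rightarrow> alg \<Rightarrow> real" where
  "reject_prob G A = measure_pmf.prob (run G A) {r. \<not> fst r}"

definition queries_at_most :: "alg \<Rightarrow> nat \<Rightarrow> bool" where
  "queries_at_most A Q \<longleftrightarrow> (\<forall>G. is_graph G \<longrightarrow> (\<forall>(b, q, s) \<in> set_pmf (run G A). q \<le> Q))"

definition samples_at_most :: "alg \<Rightarrow> nat \<Rightarrow> bool" where
  "samples_at_most A B \<longleftrightarrow> (\<forall>G. is_graph G \<longrightarrow> (\<forall>(b, q, s) \<in> set_pmf (run G A). s \<le> B))"

subsection \<open>Size-oblivious testers\<close>

definition tester :: "graph set \<Rightarrow> (real \<Rightarrow> alg) \<Rightarrow> bool" where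
  "tester P T \<longleftrightarrow> (\<forall>\<epsilon>\<in>{0<..<1}.
     (\<forall>G\<in>P. accept_prob G (T \<epsilon>) \<ge> 2/3) \<and>
     (\<forall>G. is_graph G \<longrightarrow> far \<epsilon> G P \<longrightarrow> reject_prob G (T \<epsilon>) \<ge> 2/3) \<and>
     (\<exists>Q. queries_at_most (T \<epsilon>) Q) \<and> (\<exists>B. samples_at_most (T \<epsilon>) B))"

definition one_sided :: "graph set \<Rightarrow> (real \<Rightarrow> alg) \<Rightarrow> bool" where
  "one_sided P T \<longleftrightarrow> (\<forall>\<epsilon>\<in>{0<..<1}. \<forall>G\<in>P. accept_prob G (T \<epsilon>) = 1)"

definition has_tester :: "graph set \<Rightarrow> (real \<Rightarrow> nat) \<Rightarrow> bool" where
  "has_tester P Q \<longleftrightarrow> (\<exists>T. tester P T \<and> (\<forall>\<epsilon>\<in>{0<..<1}. queries_at_most (T \<epsilon>) (Q \<epsilon>)))"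

definition has_one_sided_tester :: "graph set \<Rightarrow> (real \<Rightarrow> nat) \<Rightarrow> bool" where
  "has_one_sided_tester P Q \<longleftrightarrow>
     (\<exists>T. tester P T \<and> one_sided P T \<and> (\<forall>\<epsilon>\<in>{0<..<1}. queries_at_most (T \<epsilon>) (Q \<epsilon>)))"

subsection \<open>Canonical testers and the canonicalization convention\<close>

text \<open>\<open>query_pairs ps E k\<close> queries the pairs in \<open>ps\<close> and continues with \<open>k\<close> applied to \<open>E\<close> enlarged
  by the edges found.\<close>

primrec query_pairs ::
  "(nat \<times> nat) list \<Rightarrow> nat set set \<Rightarrow> (nat set set \<Rightarrow> alg) \<Rightarrow> alg" where
  "query_pairs [] E k = k E"
| "query_pairs (e # ps) E k = Query (fst e) (snd e)
     (\<lambda>b. query_pairs ps (if b then insert {fst e, snd e} E else E) k)"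

definition all_pairs :: "nat set \<Rightarrow> (nat \<times> nat) list" where
  "all_pairs S =
     (let xs = sorted_list_of_set S in filter (\<lambda>(u, v). u < v) (List.product xs xs))"

definition canonical_alg :: "nat \<Rightarrow> (graph \<Rightarrow> bool) \<Rightarrow> alg" where
  "canonical_alg m D = Sample m (\<lambda>S. query_pairs (all_pairs S) {} (\<lambda>E. Decide (D (S, E))))"

definition iso_invariant :: "(graph \<Rightarrow> bool) \<Rightarrow> bool" where
  "iso_invariant D \<longleftrightarrow> (\<forall>G G'. is_graph G \<longrightarrow> is_graph G' \<longrightarrow> iso G G' \<longrightarrow> D G = D G')"

definition canonical :: "(real \<Rightarrow> alg) \<Rightarrow> (real \<Rightarrow> nat) \<Rightarrow> bool" where
  "canonical T m \<longleftrightarrow>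
     (\<forall>\<epsilon>\<in>{0<..<1}. \<exists>D. iso_invariant D \<and> T \<epsilon> = canonical_alg (m \<epsilon>) D)"

text \<open>The standing convention of Goldreich and Trevisan type, with the implied constant \<open>A\<close> and the
  factor \<open>\<gamma>\<close> by which \<open>\<epsilon>\<close> is changed made explicit. It is recorded for one property and one query
  bound at a time because, read as a statement about all properties, it is false: an algorithm can
  detect that a graph has more than \<open>k\<close> vertices by sampling alone, without any query.\<close>

definition canonicalization_convention ::
  "real \<Rightarrow> real \<Rightarrow> graph set \<Rightarrow> (real \<Rightarrow> nat) \<Rightarrow> bool" where
  "canonicalization_convention A \<gamma> P Q \<longleftrightarrow>
     (has_tester P Q \<longrightarrow>
        (\<exists>T m. tester P T \<and> canonical T m \<and>
           (\<forall>\<epsilon>\<in>{0<..<1}. real (m \<epsilon>) \<le> A * real (Q (\<gamma> * \<epsilon>))))) \<and>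
     (has_one_sided_tester P Q \<longrightarrow>
        (\<exists>T m. tester P T \<and> one_sided P T \<and> canonical T m \<and>
           (\<forall>\<epsilon>\<in>{0<..<1}. real (m \<epsilon>) \<le> A * real (Q (\<gamma> * \<epsilon>)))))"

subsection \<open>Soft-O\<close>

text \<open>A quantity is \<open>\<O>\<close>-tilde of \<open>x\<close> if it is at most \<open>soft K k x\<close> for absolute \<open>K\<close> and \<open>k\<close>. The
  shift by 2 keeps the logarithm at least 1.\<close>

definition soft :: "real \<Rightarrow> nat \<Rightarrow> real \<Rightarrow> real" where
  "soft K k x = K * x * (log 2 (x + 2)) ^ k"

end

theory Submission
  imports Defs
begin

text \<open>
Both directions go through canonical algorithms, which draw a uniformly random vertex set \<open>S\<close> of a
prescribed size and decide from the induced subgraph \<open>G[S]\<close> alone.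

Testers give containers. Let a canonical one-sided tester draw \<open>m \<epsilon>\<close> vertices, and let \<open>H\<close> consist of
the graphs in which no vertex set of size \<open>m \<epsilon>\<close> is rejected, for any \<open>\<epsilon>\<close>. This family is hereditary,
it contains \<open>P\<close> because the error is one-sided, and a member with at least \<open>m \<epsilon>\<close> vertices is accepted
with certainty, hence is not \<open>\<epsilon>\<close>-far from \<open>P\<close> (\<open>canonical_tester_witness\<close>). If \<open>G\<close> is \<open>\<epsilon>\<close>-far from \<open>H\<close>, it
is \<open>\<epsilon>\<close>-far from \<open>P\<close>, so the rejected sets form an \<open>m \<epsilon>\<close>-uniform hypergraph on the vertices with density
at least \<open>2/3\<close>; a set inducing a member of \<open>H\<close> is independent in it. A hypergraph that dense has
containers by a direct argument (\<open>dense_hypergraph_container\<close>). Call the density of a set \<open>T\<close> the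
fraction of \<open>m\<close>-sets above \<open>T\<close> that are edges, and let the fingerprint of an independent set \<open>U\<close> be a
largest \<open>T \<subseteq> U\<close> with at most \<open>m\<close> elements and density at least \<open>2/3 - |T|/(3m)\<close>. Its density is at
least \<open>1/3\<close>, whereas an \<open>m\<close>-set of positive density is an edge; hence \<open>|T| < m\<close>. By maximality every
vertex of \<open>U - T\<close> lowers the density of \<open>T\<close> by more than \<open>1/(3m)\<close>. As the densities of the one-point
extensions of \<open>T\<close> average to the density of \<open>T\<close>, the vertices that do not lower it by that much
make up at least a \<open>1/(3m)\<close> fraction of the vertices outside \<open>T\<close>, and the container of \<open>T\<close> is obtained
by leaving them out.

Containers give testers. Draw \<open>s\<close> vertices and accept if \<open>G[S]\<close> is in \<open>H\<close>; if fewer than \<open>s\<close> vertices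
arrive, the whole graph is visible, and membership in \<open>P\<close> is decided exactly. Heredity makes the
error one-sided. A graph with at least \<open>M (\<epsilon>/2)\<close> vertices that is \<open>\<epsilon>\<close>-far from \<open>P\<close> is \<open>\<epsilon>/2\<close>-far from \<open>H\<close> by the
triangle inequality (\<open>far_from_hereditary_witness\<close>), and so has containers if it also has at least
\<open>N (\<epsilon>/2)\<close> vertices. Every accepted \<open>S\<close> contains its fingerprint \<open>T\<close> and lies in the container of \<open>T\<close>.
The union bound over all fingerprints costs at most \<open>s ^ j\<close> for those of length \<open>j\<close>, since only lists
over \<open>S\<close> itself matter, while confinement to a container has probability at most \<open>(1 - \<eta>) ^ (s - j)\<close>
(\<open>card_contained_sets_le\<close>). The sum over \<open>j \<le> q\<close> falls below \<open>1/3\<close> once \<open>s\<close> is of order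
\<open>(q + 1) / \<eta>\<close> times its logarithm (\<open>sample_size_suffices\<close>), and querying all pairs of the sample
squares this quantity.
\<close>

section \<open>Distance to a property\<close>

lemma graph_property_is_graph: "graph_property P \<Longrightarrow> G \<in> P \<Longrightarrow> is_graph G"
  by (simp add: graph_property_def)

lemma graph_dist_triangle:
  assumes "is_graph G" "is_graph G'" "is_graph G''" "verts G' = verts G"
  shows "graph_dist G G'' \<le> graph_dist G G' + graph_dist G' G''"
proof -
  have fin: "finite (edges K)" if "is_graph K" for K
    using that unfolding is_graph_def by (auto intro: finite_subset[of _ "Pow (verts K)"])
  have "card (sym_diff (edges G) (edges G''))
      \<le> card (sym_diff (edges G) (edges G') \<union> sym_diff (edges G') (edges G''))"
    using fin assms by (intro card_mono) auto
  also have "\<dots> \<le> card (sym_diff (edges G) (edges G')) + card (sym_diff (edges G') (edges G''))"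
    by (rule card_Un_le)
  finally have "real (card (sym_diff (edges G) (edges G'')))
      \<le> real (card (sym_diff (edges G) (edges G'))) + real (card (sym_diff (edges G') (edges G'')))"
    by linarith
  then show ?thesis
    using assms(4) by (simp add: graph_dist_def divide_right_mono flip: add_divide_distrib)
qed

text \<open>Only finitely many members of a property live on a given vertex set, so the infimum that defines
  the distance is attained unless it ranges over the empty set, where it is infinite.\<close>

lemma not_far_iff:
  assumes "graph_property P" "is_graph G"
  shows "\<not> far \<epsilon> G P \<longleftrightarrow> (\<exists>G'\<in>P. verts G' = verts G \<and> graph_dist G G' \<le> \<epsilon>)"
proof
  let ?X = "{G' \<in> P. verts G' = verts G}"
  assume nf: "\<not> far \<epsilon> G P"
  have "?X \<subseteq> {verts G} \<times> Pow (Pow (verts G))"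
  proof
    fix K assume "K \<in> ?X"
    then have "is_graph K" "verts K = verts G" using graph_property_is_graph[OF assms(1)] by auto
    then show "K \<in> {verts G} \<times> Pow (Pow (verts G))" by (auto simp: is_graph_def mem_Times_iff)
  qed
  moreover have "finite ({verts G} \<times> Pow (Pow (verts G)))"
    using assms(2) by (auto simp: is_graph_def)
  ultimately have "finite ?X" by (rule finite_subset)
  have "?X \<noteq> {}"
    using nf by (auto simp: far_def dist_to_def top_ereal_def simp del: Collect_empty_eq)
  then have "dist_to G P \<in> (\<lambda>G'. ereal (graph_dist G G')) ` ?X"
    using \<open>finite ?X\<close> unfolding dist_to_def
    by (subst cInf_eq_Min) (auto intro!: Min_in simp del: Collect_empty_eq)
  then show "\<exists>G'\<in>P. verts G' = verts G \<and> graph_dist G G' \<le> \<epsilon>"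
    using nf by (auto simp: far_def)
next
  assume "\<exists>G'\<in>P. verts G' = verts G \<and> graph_dist G G' \<le> \<epsilon>"
  then obtain G' where "G' \<in> P" "verts G' = verts G" "graph_dist G G' \<le> \<epsilon>" by blast
  then have "dist_to G P \<le> ereal \<epsilon>"
    unfolding dist_to_def by (intro INF_lower2[of G']) auto
  then show "\<not> far \<epsilon> G P" by (simp add: far_def)
qed

lemma far_antimono: "far \<epsilon> G H \<Longrightarrow> P \<subseteq> H \<Longrightarrow> far \<epsilon> G P"
  unfolding far_def dist_to_def by (erule less_le_trans, rule INF_superset_mono) auto

lemma not_far_self: "graph_property P \<Longrightarrow> G \<in> P \<Longrightarrow> 0 \<le> \<epsilon> \<Longrightarrow> \<not> far \<epsilon> G P"
  using not_far_iff[of P G \<epsilon>] by (fastforce simp: graph_dist_def dest: graph_property_is_graph)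

text \<open>Spend one half of \<open>\<epsilon>\<close> on the way from \<open>G\<close> to \<open>H\<close> and the other half on the way from there to \<open>P\<close>;
  the intermediate graph has the same vertices, hence is large enough for the witness to apply.\<close>

lemma far_from_hereditary_witness:
  assumes P: "graph_property P" and W: "semi_hereditary_witness P H M"
    and G: "is_graph G" and \<epsilon>: "\<epsilon> \<in> {0<..<1}"
    and M: "M (\<epsilon>/2) \<le> card (verts G)" and far: "far \<epsilon> G P"
  shows "far (\<epsilon>/2) G H"
proof (rule ccontr)
  assume "\<not> far (\<epsilon>/2) G H"
  moreover have H: "graph_property H" using W by (simp add: semi_hereditary_witness_def hereditary_def)
  ultimately obtain G' where G': "G' \<in> H" "verts G' = verts G" "graph_dist G G' \<le> \<epsilon>/2"
    using G by (auto simp: not_far_iff)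
  then have "\<not> far (\<epsilon>/2) G' P" using W \<epsilon> M by (auto simp: semi_hereditary_witness_def)
  moreover have isG': "is_graph G'" using H G'(1) by (rule graph_property_is_graph)
  ultimately obtain G'' where G'': "G'' \<in> P" "verts G'' = verts G'" "graph_dist G' G'' \<le> \<epsilon>/2"
    using P by (auto simp: not_far_iff)
  then have "is_graph G''" using P by (blast intro: graph_property_is_graph)
  then have "graph_dist G G'' \<le> \<epsilon>"
    using graph_dist_triangle[OF G isG'] G'(2,3) G''(3) by fastforce
  then have "\<not> far \<epsilon> G P" using G' G'' P G by (auto simp: not_far_iff)
  with far show False by simp
qed

section \<open>Executions of canonical algorithms\<close>

lemma run_query_pairs:
  "run G (query_pairs ps E (\<lambda>E. Decide (D E))) =
     return_pmf (D (E \<union> {{u, v} | u v. (u, v) \<in> set ps \<and> {u, v} \<in> edges G}), length ps, 0)"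
proof (induction ps arbitrary: E)
  case (Cons e ps)
  have eq: "(if {fst e, snd e} \<in> edges G then insert {fst e, snd e} E else E)
      \<union> {{u, v} | u v. (u, v) \<in> set ps \<and> {u, v} \<in> edges G}
    = E \<union> {{u, v} | u v. (u, v) \<in> set (e # ps) \<and> {u, v} \<in> edges G}"
    by (cases e) auto
  show ?case unfolding query_pairs.simps run.simps Cons.IH eq by simp
qed simp

lemma edges_from_all_pairs:
  assumes "is_graph G" "S \<subseteq> verts G"
  shows "{{u, v} | u v. (u, v) \<in> set (all_pairs S) \<and> {u, v} \<in> edges G} = edges (induced G S)"
proof -
  have "finite S" using assms finite_subset by (auto simp: is_graph_def)
  then have ps: "set (all_pairs S) = {(u, v). u \<in> S \<and> v \<in> S \<and> u < v}"
    by (auto simp: all_pairs_def Let_def)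
  have "\<exists>u v. e = {u, v} \<and> u \<in> S \<and> v \<in> S \<and> u < v" if e: "e \<in> edges G" "e \<subseteq> S" for e
  proof -
    have "card e = 2" using e assms by (auto simp: is_graph_def)
    then obtain u v where "e = {u, v}" "u \<noteq> v" by (auto simp: card_2_iff)
    then show ?thesis
      using e(2) by (cases u v rule: linorder_cases) (auto simp: insert_commute)
  qed
  then show ?thesis unfolding ps induced_def by fastforce
qed

lemma random_subset_support:
  assumes "is_graph G"
  shows "set_pmf (random_subset G m) = {S. S \<subseteq> verts G \<and> card S = min m (card (verts G))}"
    "finite {S. S \<subseteq> verts G \<and> card S = min m (card (verts G))}"
    "{S. S \<subseteq> verts G \<and> card S = min m (card (verts G))} \<noteq> {}"
proof -
  let ?X = "{S. S \<subseteq> verts G \<and> card S = min m (card (verts G))}"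
  show fin: "finite ?X" using assms by (auto simp: is_graph_def)
  obtain S where "S \<subseteq> verts G" "card S = min m (card (verts G))"
    by (rule obtain_subset_with_card_n[of "min m (card (verts G))" "verts G"]) simp_all
  then show ne: "?X \<noteq> {}" by blast
  show "set_pmf (random_subset G m) = ?X"
    using fin ne by (simp add: random_subset_def set_pmf_of_set)
qed

lemma run_canonical_alg:
  assumes "is_graph G"
  shows "run G (canonical_alg m D) =
    map_pmf (\<lambda>S. (D (induced G S), length (all_pairs S), card S)) (random_subset G m)"
proof -
  have sub: "S \<subseteq> verts G" if "S \<in> set_pmf (random_subset G m)" for S
    using that by (simp add: random_subset_support[OF assms])
  have "run G (canonical_alg m D) = bind_pmf (random_subset G m)
     (\<lambda>S. return_pmf (D (induced G S), length (all_pairs S), card S))"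
    unfolding canonical_alg_def run.simps run_query_pairs
    using edges_from_all_pairs[OF assms sub]
    by (intro bind_pmf_cong) (auto simp: induced_def)
  then show ?thesis by (simp add: map_pmf_def)
qed

lemma accept_prob_canonical_alg:
  assumes "is_graph G"
  shows "accept_prob G (canonical_alg m D) =
      measure_pmf.prob (random_subset G m) {S. D (induced G S)}"
    and "reject_prob G (canonical_alg m D) =
      measure_pmf.prob (random_subset G m) {S. \<not> D (induced G S)}"
  by (simp_all add: accept_prob_def reject_prob_def run_canonical_alg[OF assms] vimage_def)

lemma accept_prob_canonical_alg_eq_1_iff:
  assumes "is_graph G"
  shows "accept_prob G (canonical_alg m D) = 1 \<longleftrightarrow>
    (\<forall>S \<subseteq> verts G. card S = min m (card (verts G)) \<longrightarrow> D (induced G S))"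
  by (auto simp: accept_prob_canonical_alg[OF assms] measure_pmf.prob_eq_1 AE_measure_pmf_iff
      random_subset_support[OF assms])

text \<open>For graphs that are not smaller than the sample, this turns rejection probabilities into edge
  counts of the hypergraph of rejected sets.\<close>

lemma reject_prob_canonical_alg_count:
  assumes "is_graph G" "m \<le> card (verts G)"
  shows "reject_prob G (canonical_alg m D) =
    real (card {S. S \<subseteq> verts G \<and> card S = m \<and> \<not> D (induced G S)}) / real (card (verts G) choose m)"
proof -
  have "finite (verts G)" using assms(1) by (simp add: is_graph_def)
  then have "card {S. S \<subseteq> verts G \<and> card S = m} = card (verts G) choose m" by (rule n_subsets)
  then show ?thesis
    using random_subset_support(2,3)[OF assms(1), of m] assms(2)
    by (simp add: accept_prob_canonical_alg[OF assms(1)] random_subset_def measure_pmf_of_set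
        Collect_conj_eq Int_assoc)
qed

lemma length_all_pairs_le: "length (all_pairs S) \<le> (card S)\<^sup>2"
proof -
  have "length (all_pairs S) \<le> length (List.product (sorted_list_of_set S) (sorted_list_of_set S))"
    unfolding all_pairs_def Let_def by (rule length_filter_le)
  then show ?thesis by (simp add: length_product power2_eq_square)
qed

lemma canonical_alg_complexity:
  "queries_at_most (canonical_alg m D) (m\<^sup>2)" "samples_at_most (canonical_alg m D) m"
proof -
  have "length (all_pairs S) \<le> m\<^sup>2" if "card S \<le> m" for S
    using length_all_pairs_le[of S] power_mono[OF that, of 2] by linarith
  then show "queries_at_most (canonical_alg m D) (m\<^sup>2)" "samples_at_most (canonical_alg m D) m"
    by (auto simp: queries_at_most_def samples_at_most_def run_canonical_alg random_subset_support)
qed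

section \<open>Containers for dense uniform hypergraphs\<close>

text \<open>The probability that a uniformly random \<open>m\<close>-element superset of \<open>T\<close> in \<open>V\<close> belongs to \<open>F\<close>.\<close>

definition link_density :: "'a set \<Rightarrow> nat \<Rightarrow> 'a set set \<Rightarrow> 'a set \<Rightarrow> real" where
  "link_density V m F T =
     real (card {S \<in> F. T \<subseteq> S}) / real ((card V - card T) choose (m - card T))"

lemma card_subsets_above:
  assumes "finite V" "T \<subseteq> V" "card T \<le> m"
  shows "card {S. T \<subseteq> S \<and> S \<subseteq> V \<and> card S = m} = (card V - card T) choose (m - card T)"
proof -
  have fT: "finite T" using assms finite_subset by blast
  have "bij_betw (\<lambda>S. S - T) {S. T \<subseteq> S \<and> S \<subseteq> V \<and> card S = m} {R. R \<subseteq> V - T \<and> card R = m - card T}"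
  proof (rule bij_betw_byWitness[where f' = "\<lambda>R. R \<union> T"], goal_cases)
    case 4
    have "card (R \<union> T) = card R + card T" if "R \<subseteq> V - T" for R
      using that assms(1) fT by (intro card_Un_disjoint) (auto intro: finite_subset)
    then show ?case using assms by auto
  qed (use assms fT in \<open>auto simp: card_Diff_subset\<close>)
  then have "card {S. T \<subseteq> S \<and> S \<subseteq> V \<and> card S = m} = card {R. R \<subseteq> V - T \<and> card R = m - card T}"
    by (rule bij_betw_same_card)
  also have "\<dots> = card (V - T) choose (m - card T)"
    using assms by (intro n_subsets) auto
  finally show ?thesis using assms fT by (simp add: card_Diff_subset)
qed

lemma link_density_le_1:
  assumes "finite V" "T \<subseteq> V" "card T \<le> m" "F \<subseteq> {S. S \<subseteq> V \<and> card S = m}"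
  shows "link_density V m F T \<le> 1"
proof -
  have "finite {S. T \<subseteq> S \<and> S \<subseteq> V \<and> card S = m}" using assms(1) by auto
  then have "card {S \<in> F. T \<subseteq> S} \<le> card {S. T \<subseteq> S \<and> S \<subseteq> V \<and> card S = m}"
    using assms(4) by (intro card_mono) auto
  then show ?thesis using assms by (auto simp: link_density_def card_subsets_above divide_le_eq_1)
qed

text \<open>A uniformly random \<open>m\<close>-set above \<open>T\<close> can be drawn by first adding a uniformly random vertex to \<open>T\<close>.
  The proof counts the pairs of an edge above \<open>T\<close> and one of its vertices outside \<open>T\<close> in two ways.\<close>

lemma sum_link_density:
  assumes V: "finite V" "T \<subseteq> V" and m: "card T < m" "m \<le> card V"
    and F: "F \<subseteq> {S. S \<subseteq> V \<and> card S = m}"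
  shows "(\<Sum>v\<in>V - T. link_density V m F (insert v T)) = real (card (V - T)) * link_density V m F T"
proof -
  define r where "r = m - card T - 1"
  define w where "w = card V - card T - 1"
  have fT: "finite T" using V finite_subset by blast
  have r: "m - card T = Suc r" and w: "card V - card T = Suc w"
    using m by (auto simp: r_def w_def)
  have fF: "finite F" using F V(1) by (auto intro: finite_subset[of _ "Pow V"])
  have ins: "{S \<in> F. insert v T \<subseteq> S} = {S \<in> {S \<in> F. T \<subseteq> S}. v \<in> S}" for v by auto
  have "(\<Sum>v\<in>V - T. card {S \<in> F. insert v T \<subseteq> S}) = (\<Sum>v\<in>V - T. card {S \<in> {S \<in> F. T \<subseteq> S}. v \<in> S})"
    by (simp only: ins)
  also have "\<dots> = Suc r * card {S \<in> F. T \<subseteq> S}"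
  proof (rule sum_multicount)
    show "\<forall>S\<in>{S \<in> F. T \<subseteq> S}. card {v \<in> V - T. v \<in> S} = Suc r"
    proof
      fix S assume "S \<in> {S \<in> F. T \<subseteq> S}"
      then have "{v \<in> V - T. v \<in> S} = S - T" "T \<subseteq> S" "card S = m" using F by auto
      then show "card {v \<in> V - T. v \<in> S} = Suc r" using fT r by (simp add: card_Diff_subset)
    qed
  qed (use V fF in auto)
  finally have "real (\<Sum>v\<in>V - T. card {S \<in> F. insert v T \<subseteq> S}) = real (Suc r * card {S \<in> F. T \<subseteq> S})"
    by (rule arg_cong)
  then have sum: "(\<Sum>v\<in>V - T. real (card {S \<in> F. insert v T \<subseteq> S}))
      = real (Suc r) * real (card {S \<in> F. T \<subseteq> S})"
    by (simp only: of_nat_mult of_nat_sum)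
  have dens: "link_density V m F (insert v T) = real (card {S \<in> F. insert v T \<subseteq> S}) / real (w choose r)"
    if "v \<in> V - T" for v
  proof -
    have "card (insert v T) = Suc (card T)" using that fT by auto
    then have "card V - card (insert v T) = w" "m - card (insert v T) = r"
      by (auto simp: r_def w_def)
    then show ?thesis by (simp add: link_density_def)
  qed
  have le: "r \<le> w" using m by (auto simp: r_def w_def)
  then have pos: "real (w choose r) > 0" "real (Suc w choose Suc r) > 0"
    by (auto simp: zero_less_binomial_iff simp del: binomial_Suc_Suc)
  have "real (Suc r) * real (Suc w choose Suc r) = real (Suc w) * real (w choose r)"
    by (metis Suc_times_binomial_eq mult.commute of_nat_mult)
  then have "real (Suc r) / real (w choose r) = real (Suc w) / real (Suc w choose Suc r)"
    using pos by (simp add: frac_eq_eq del: binomial_Suc_Suc)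
  then have "real (Suc r) * real (card {S \<in> F. T \<subseteq> S}) / real (w choose r)
      = real (Suc w) * (real (card {S \<in> F. T \<subseteq> S}) / real (Suc w choose Suc r))"
    by (metis (no_types) times_divide_eq_left times_divide_eq_right mult.commute)
  moreover have "card (V - T) = Suc w" using V fT w by (simp add: card_Diff_subset)
  ultimately show ?thesis
    using sum by (simp add: dens flip: sum_divide_distrib, simp add: link_density_def r w)
qed

text \<open>The container is attached to the fingerprint \<open>T\<close>; it must not depend on the independent set \<open>U\<close>
  from which \<open>T\<close> was chosen. The assumption \<open>2 * m \<le> card V\<close> ensures that at least half of the
  vertices lie outside \<open>T\<close>, so a given fraction of those is at least half that fraction of all
  vertices.\<close>

theorem dense_hypergraph_container:
  fixes V :: "'a set"
  assumes V: "finite V" and m: "0 < m" "2 * m \<le> card V"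
    and F: "F \<subseteq> {S. S \<subseteq> V \<and> card S = m}"
    and dense: "real (card F) \<ge> 2/3 * real (card V choose m)"
  shows "\<exists>C. \<forall>U\<subseteq>V. (\<forall>S\<in>F. \<not> S \<subseteq> U) \<longrightarrow> (\<exists>T\<subseteq>U. card T \<le> m \<and> U \<subseteq> C T \<and> C T \<subseteq> V \<and>
      real (card (C T)) \<le> (1 - 1 / (6 * real m)) * real (card V))"
proof -
  let ?d = "link_density V m F"
  define \<delta> where "\<delta> = 1 / (3 * real m)"
  \<comment> \<open>The vertices that lower the density of \<open>T\<close> only little; the container is their complement.\<close>
  define A where "A T = {v \<in> V - T. ?d (insert v T) \<ge> ?d T - \<delta>}" for T
  have \<delta>: "\<delta> > 0" "\<delta> \<le> 1/3" using m by (auto simp: \<delta>_def)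
  have small: "real (card (V - A T)) \<le> (1 - 1 / (6 * real m)) * real (card V)"
    if T: "T \<subseteq> V" "card T < m" "?d T \<ge> 1/3" for T
  proof -
    let ?W = "V - T"
    have fT: "finite T" using T V finite_subset by blast
    have A: "A T \<subseteq> ?W" "finite ?W" using V by (auto simp: A_def)
    have "real (card ?W) * ?d T = (\<Sum>v\<in>?W. ?d (insert v T))"
      using sum_link_density[OF V T(1,2) _ F] m by simp
    also have "\<dots> \<le> (\<Sum>v\<in>?W. (?d T - \<delta>) + (if v \<in> A T then 1 else 0))"
    proof (rule sum_mono)
      fix v assume v: "v \<in> ?W"
      then have "card (insert v T) \<le> m" using T fT by auto
      then have "?d (insert v T) \<le> 1" using v T V F by (intro link_density_le_1) auto
      then show "?d (insert v T) \<le> (?d T - \<delta>) + (if v \<in> A T then 1 else 0)"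
        using v T(3) \<delta> by (auto simp: A_def)
    qed
    also have "\<dots> = real (card ?W) * (?d T - \<delta>) + real (card (A T))"
      using A by (simp add: sum.distrib sum.If_cases Int_absorb1)
    finally have "\<delta> * real (card ?W) \<le> real (card (A T))" by (simp add: algebra_simps)
    moreover have "\<delta> * (real (card V) / 2) \<le> \<delta> * real (card ?W)"
      using T m \<delta> fT by (intro mult_left_mono) (auto simp: card_Diff_subset)
    moreover have "A T \<subseteq> V" using A by auto
    then have "real (card (V - A T)) = real (card V) - real (card (A T))"
      using V by (simp add: card_Diff_subset finite_subset of_nat_diff card_mono)
    ultimately have "real (card (V - A T)) \<le> real (card V) - \<delta> * (real (card V) / 2)" by linarith
    then show ?thesis by (simp add: \<delta>_def algebra_simps)
  qed
  have "\<exists>T\<subseteq>U. card T \<le> m \<and> U \<subseteq> V - A T \<and> V - A T \<subseteq> V \<and>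
      real (card (V - A T)) \<le> (1 - 1 / (6 * real m)) * real (card V)"
    if U: "U \<subseteq> V" "\<forall>S\<in>F. \<not> S \<subseteq> U" for U
  proof -
    \<comment> \<open>Losing at most \<open>\<delta> = 1/(3m)\<close> per vertex costs at most \<open>1/3\<close> in all, so good sets keep density \<open>1/3\<close>.\<close>
    define good where "good T \<longleftrightarrow> T \<subseteq> U \<and> card T \<le> m \<and> ?d T \<ge> 2/3 - real (card T) * \<delta>" for T
    have fU: "finite U" using U V finite_subset by blast
    have "{S \<in> F. {} \<subseteq> S} = F" by auto
    then have "good {}" using dense m by (simp add: good_def link_density_def field_simps)
    moreover have "\<forall>T. good T \<longrightarrow> card T < Suc m" by (auto simp: good_def)
    ultimately obtain T where T: "good T" and max: "\<And>T'. good T' \<Longrightarrow> card T' \<le> card T"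
      using ex_has_greatest_nat[of good "{}" card "Suc m"] by blast
    have TU: "T \<subseteq> U" "card T \<le> m" and fT: "finite T"
      using T fU finite_subset by (auto simp: good_def)
    have "real (card T) * \<delta> \<le> real m * \<delta>" using TU \<delta> by simp
    also have "\<dots> = 1/3" using m by (simp add: \<delta>_def)
    finally have d: "?d T \<ge> 1/3" using T by (auto simp: good_def)
    have lt: "card T < m"
    proof (rule ccontr)
      assume "\<not> card T < m"
      have "{S \<in> F. T \<subseteq> S} \<noteq> {}" using d unfolding link_density_def by (auto simp del: Collect_empty_eq)
      then obtain S where S: "S \<in> F" "T \<subseteq> S" by blast
      moreover have "finite S" "card S = m" using S F finite_subset[OF _ V] by auto
      ultimately have "T = S" using \<open>\<not> card T < m\<close> TU by (metis card_subset_eq le_neq_implies_less)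
      then show False using S U TU by blast
    qed
    have "v \<notin> A T" if v: "v \<in> U" for v
    proof
      assume "v \<in> A T"
      then have "v \<notin> T" "?d (insert v T) \<ge> ?d T - \<delta>" by (auto simp: A_def)
      then have "good (insert v T)"
        using T v lt fT by (auto simp: good_def algebra_simps)
      then show False using max[of "insert v T"] \<open>v \<notin> T\<close> fT by simp
    qed
    then show ?thesis using TU U small[OF _ lt d] by (intro exI[of _ T]) auto
  qed
  then show ?thesis by (intro exI[of _ "\<lambda>T. V - A T"]) blast
qed

section \<open>Counting independent sets through containers\<close>

text \<open>The ratio of the two binomial coefficients is the product of the fractions \<open>(c - i) / (n - i)\<close>,
  each of which is at most \<open>\<rho>\<close>.\<close>

lemma binomial_le_power_times_binomial:
  fixes \<rho> :: real
  assumes "real c \<le> \<rho> * real n" "\<rho> \<le> 1"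
  shows "real (c choose k) \<le> \<rho> ^ k * real (n choose k)"
proof (cases "k \<le> c")
  case False
  then have "c choose k = 0" by simp
  moreover have "\<rho> \<ge> 0 \<or> n choose k = 0"
  proof (cases "\<rho> \<ge> 0")
    case False
    then have "n = 0" using assms(1)
      by (smt (verit) mult_neg_pos of_nat_0_le_iff of_nat_0_less_iff gr0I)
    then show ?thesis using \<open>\<not> k \<le> c\<close> by simp
  qed simp
  ultimately show ?thesis by (metis mult_nonneg_nonneg mult_zero_right of_nat_0 of_nat_0_le_iff zero_le_power order_refl)
next
  case True
  then show ?thesis
  proof (induction k)
    case (Suc k)
    have step: "real (Suc k) * real (b choose Suc k) = (real b - real k) * real (b choose k)" for b
    proof (cases "k \<le> b")
      case True
      have "Suc k * (b choose Suc k) = (b - k) * (b choose k)"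
        using binomial_absorption[of k b] binomial_absorb_comp[of b k] by simp
      then have "real (Suc k) * real (b choose Suc k) = real (b - k) * real (b choose k)"
        by (metis of_nat_mult)
      with True show ?thesis by (simp add: of_nat_diff)
    qed (simp add: binomial_eq_0)
    have "c > 0" using Suc.prems by simp
    then have n: "n > 0" "\<rho> > 0"
      using less_le_trans[of 0 "real c" "\<rho> * real n"] assms(1) by (simp_all add: zero_less_mult_iff)
    have "\<rho> * real k \<le> 1 * real k" using assms(2) by (intro mult_right_mono) auto
    then have kn: "real c - real k \<le> \<rho> * (real n - real k)"
      using assms(1) by (simp add: algebra_simps)
    have "real (Suc k) * real (c choose Suc k) = (real c - real k) * real (c choose k)" by (rule step)
    also have "\<dots> \<le> (\<rho> * (real n - real k)) * (\<rho> ^ k * real (n choose k))"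
      using kn Suc n by (intro mult_mono) auto
    also have "\<dots> = \<rho> ^ Suc k * ((real n - real k) * real (n choose k))" by simp
    also have "\<dots> = real (Suc k) * (\<rho> ^ Suc k * real (n choose Suc k))"
      by (simp only: step[symmetric] mult.left_commute)
    finally show ?case by (simp add: mult_le_cancel_left_pos del: of_nat_Suc power_Suc binomial_Suc_Suc)
  qed simp
qed

text \<open>A union bound over fingerprints, written as a count. The sets with fingerprint \<open>T\<close> of length \<open>j\<close>
  lie between \<open>set T\<close> and \<open>C T\<close>, and their number is at most a \<open>(1 - \<eta>) ^ (s - j)\<close> fraction of that of all
  \<open>s\<close>-sets above \<open>set T\<close>. Summing the latter over the lists \<open>T\<close> of length \<open>j\<close> counts every \<open>s\<close>-set once for
  each such list over its elements, that is at most \<open>s ^ j\<close> times, whatever the number of vertices.\<close>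

lemma card_contained_sets_le:
  fixes \<eta> :: real
  assumes V: "finite V"
    and fp: "\<And>S. S \<in> X \<Longrightarrow> S \<subseteq> V \<and> card S = s \<and> length (f S) \<le> q \<and> distinct (f S) \<and> set (f S) \<subseteq> S \<and>
        C (f S) \<subseteq> V \<and> real (card (C (f S))) \<le> (1 - \<eta>) * real (card V) \<and> S \<subseteq> C (f S)"
    and \<eta>: "0 < \<eta>" "\<eta> \<le> 1"
  shows "real (card X) \<le> (\<Sum>j\<le>q. real s ^ j * (1 - \<eta>) ^ (s - j)) * real (card V choose s)"
proof -
  define n where "n = card V"
  define L where "L = f ` X"
  define above where "above T = {S. set T \<subseteq> S \<and> S \<subseteq> V \<and> card S = s}" for T
  define Y where "Y = {S. S \<subseteq> V \<and> card S = s}"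
  have Y: "finite Y" "card Y = n choose s" using V by (auto simp: Y_def n_def n_subsets)
  have above: "above T = {S \<in> Y. set T \<subseteq> S}" for T by (auto simp: above_def Y_def)
  have XY: "X \<subseteq> Y" using fp by (auto simp: Y_def)
  then have fL: "finite L" using Y finite_subset by (auto simp: L_def)
  have cell: "real (card {S \<in> X. f S = T}) \<le> (1 - \<eta>) ^ (s - length T) * real (card (above T))"
    if T: "T \<in> L" for T
  proof -
    obtain S0 where S0: "S0 \<in> X" "f S0 = T" using T by (auto simp: L_def)
    have TC: "set T \<subseteq> C T" and CV: "C T \<subseteq> V" and dT: "card (set T) = length T"
      and sz: "real (card (C T)) \<le> (1 - \<eta>) * real n" and Ts: "length T \<le> s"
      using fp[OF S0(1)] S0(2) V distinct_card[of T] card_mono[of S0 "set T"] finite_subset[of S0 V]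
      by (auto simp: n_def)
    have fC: "finite (C T)" using CV V finite_subset by blast
    have le: "length T \<le> card (C T)" "card (C T) \<le> n"
      using card_mono[OF fC TC] card_mono[OF V CV] dT by (auto simp: n_def)
    have "{S \<in> X. f S = T} \<subseteq> {S. set T \<subseteq> S \<and> S \<subseteq> C T \<and> card S = s}" using fp by auto
    then have "card {S \<in> X. f S = T} \<le> card {S. set T \<subseteq> S \<and> S \<subseteq> C T \<and> card S = s}"
      using fC by (intro card_mono) auto
    also have "\<dots> = (card (C T) - length T) choose (s - length T)"
      using card_subsets_above[OF fC TC] dT Ts by simp
    finally have "real (card {S \<in> X. f S = T}) \<le> real ((card (C T) - length T) choose (s - length T))"
      by simp
    also have "\<dots> \<le> (1 - \<eta>) ^ (s - length T) * real ((n - length T) choose (s - length T))"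
    proof (rule binomial_le_power_times_binomial)
      have "\<eta> * real (length T) \<ge> 0" using \<eta> by simp
      then show "real (card (C T) - length T) \<le> (1 - \<eta>) * real (n - length T)"
        using sz le by (simp add: of_nat_diff algebra_simps)
    qed (use \<eta> in simp)
    also have "(n - length T) choose (s - length T) = card (above T)"
      using card_subsets_above[OF V, of "set T" s] TC CV dT Ts by (simp add: above_def n_def)
    finally show ?thesis .
  qed
  have layer: "(\<Sum>T\<in>{T \<in> L. length T = j}. card (above T)) \<le> s ^ j * (n choose s)" for j
  proof -
    have "(\<Sum>T\<in>{T \<in> L. length T = j}. card (above T))
        = (\<Sum>S\<in>Y. card {T \<in> {T \<in> L. length T = j}. set T \<subseteq> S})"
      unfolding above using fL Y by (intro sum_multicount_gen) auto
    also have "\<dots> \<le> (\<Sum>S\<in>Y. s ^ j)"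
    proof (rule sum_mono)
      fix S assume "S \<in> Y"
      then have S: "finite S" "card S = s" using V finite_subset by (auto simp: Y_def)
      have "card {T \<in> {T \<in> L. length T = j}. set T \<subseteq> S} \<le> card {T. set T \<subseteq> S \<and> length T = j}"
        using S by (intro card_mono finite_lists_length_eq) auto
      then show "card {T \<in> {T \<in> L. length T = j}. set T \<subseteq> S} \<le> s ^ j"
        using S card_lists_length_eq[of S j] by simp
    qed
    also have "\<dots> = s ^ j * (n choose s)" using Y by simp
    finally show ?thesis .
  qed
  have Lq: "length T \<le> q" if "T \<in> L" for T using that fp by (auto simp: L_def)
  have "card X = (\<Sum>T\<in>L. card {S \<in> X. f S = T})"
    using sum.image_gen[of X "\<lambda>_. 1 :: nat" f] XY Y finite_subset by (auto simp: L_def)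
  then have "real (card X) = (\<Sum>T\<in>L. real (card {S \<in> X. f S = T}))" by simp
  also have "\<dots> \<le> (\<Sum>T\<in>L. (1 - \<eta>) ^ (s - length T) * real (card (above T)))"
    by (intro sum_mono cell)
  also have "\<dots> = (\<Sum>j\<le>q. \<Sum>T\<in>{T \<in> L. length T = j}. (1 - \<eta>) ^ (s - length T) * real (card (above T)))"
    using fL Lq by (intro sum.group[symmetric]) auto
  also have "\<dots> = (\<Sum>j\<le>q. (1 - \<eta>) ^ (s - j) * real (\<Sum>T\<in>{T \<in> L. length T = j}. card (above T)))"
    by (intro sum.cong refl) (auto simp: sum_distrib_left)
  also have "\<dots> \<le> (\<Sum>j\<le>q. (1 - \<eta>) ^ (s - j) * real (s ^ j * (n choose s)))"
    using layer \<eta> by (intro sum_mono mult_left_mono) (auto simp flip: of_nat_sum simp del: of_nat_mult of_nat_power)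
  also have "\<dots> = (\<Sum>j\<le>q. real s ^ j * (1 - \<eta>) ^ (s - j)) * real (n choose s)"
    by (simp add: sum_distrib_left sum_distrib_right mult_ac)
  finally show ?thesis by (simp add: n_def)
qed

text \<open>With \<open>a = (q + 1) / \<eta>\<close>, the condition to be met is \<open>3 (q + 1) s ^ q exp (- \<eta> (s - q)) \<le> 1\<close>. Bounding
  \<open>ln s\<close> by its tangent at \<open>4 a\<close> costs a quarter of the exponent \<open>\<eta> s\<close>; the factor \<open>4/3\<close> makes up for it.\<close>

definition sample_size :: "nat \<Rightarrow> real \<Rightarrow> nat" where
  "sample_size q \<eta> = (let a = (real q + 1) / \<eta> in nat \<lceil>4/3 * a * ln (4 * a)\<rceil>)"

lemma ln_4_bounds: "1 \<le> ln (4::real)" "ln (4::real) \<le> 2"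
proof -
  have "exp (1::real) \<le> 3" by (rule exp_le)
  then show "1 \<le> ln (4::real)" by (simp add: ln_ge_iff)
  have "ln (4::real) = 2 * ln 2" using ln_realpow[of 2 2] by simp
  then show "ln (4::real) \<le> 2" using ln_2_less_1 by simp
qed

text \<open>Every larger sample works as well, because the tester may have to raise the sample size in order
  to reach the thresholds of the witness and of the container lemma.\<close>

lemma sample_size_suffices:
  fixes \<eta> :: real
  assumes \<eta>: "0 < \<eta>" "\<eta> \<le> 1" and s: "s \<ge> sample_size q \<eta>"
  shows "(\<Sum>j\<le>q. real s ^ j * (1 - \<eta>) ^ (s - j)) \<le> 1/3"
proof -
  define a where "a = (real q + 1) / \<eta>"
  have a: "real q + 1 \<le> a" "1 \<le> a" and \<eta>a: "\<eta> * a = real q + 1"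
    using \<eta> mult_left_le_one_le[of "real q + 1" \<eta>] by (auto simp: a_def field_simps)
  have ln4a: "ln (4 * a) = ln 4 + ln a" using a by (simp add: ln_mult)
  then have "1 \<le> ln (4 * a)" using a ln_4_bounds ln_ge_zero[of a] by linarith
  then have aln: "a * 1 \<le> a * ln (4 * a)" using a by (intro mult_left_mono) auto
  have sa: "real s \<ge> 4/3 * a * ln (4 * a)"
    using s unfolding sample_size_def a_def[symmetric] Let_def by linarith
  then have s1: "real s \<ge> a" using aln a by linarith
  then have sq: "s \<ge> q" "s \<ge> 1" using a by linarith+
  have each: "real s ^ j * (1 - \<eta>) ^ (s - j) \<le> real s ^ q * exp (- \<eta> * (real s - real q))"
    if "j \<le> q" for j
  proof -
    have "(1 - \<eta>) ^ (s - j) \<le> (1 - \<eta>) ^ (s - q)"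
      using that \<eta> by (intro power_decreasing) auto
    also have "\<dots> \<le> exp (- \<eta>) ^ (s - q)"
      using \<eta> exp_ge_add_one_self[of "- \<eta>"] by (intro power_mono) auto
    also have "\<dots> = exp (- \<eta> * (real s - real q))"
      using sq by (simp add: of_nat_diff mult.commute flip: exp_of_nat_mult)
    finally show ?thesis using that sq \<eta> by (intro mult_mono power_increasing) auto
  qed
  \<comment> \<open>The tangent of the logarithm at \<open>4 * a\<close>.\<close>
  have "ln (real s) = ln (4 * a) + ln (real s / (4 * a))" using a sq by (simp add: ln_div)
  also have "\<dots> \<le> ln (4 * a) + (real s / (4 * a) - 1)"
    using a sq by (intro add_left_mono ln_le_minus_one) auto
  finally have "real q * ln (real s) \<le> real q * (ln (4 * a) + (real s / (4 * a) - 1))"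
    by (intro mult_left_mono) auto
  also have "\<dots> = real q * ln (4 * a) + real q * (real s / (4 * a)) - real q"
    by (simp add: algebra_simps)
  also have "real q * (real s / (4 * a)) \<le> (\<eta> * a) * (real s / (4 * a))"
    using \<eta>a a by (intro mult_right_mono) auto
  also have "\<dots> = \<eta> * real s / 4" using a by simp
  finally have qln: "real q * ln (real s) \<le> real q * ln (4 * a) + \<eta> * real s / 4 - real q" by simp
  have "\<eta> * (4/3 * a * ln (4 * a)) \<le> \<eta> * real s" using sa \<eta> by (intro mult_left_mono) auto
  also have "\<eta> * (4/3 * a * ln (4 * a)) = 4/3 * ((\<eta> * a) * ln (4 * a))" by (simp add: algebra_simps)
  also have "\<dots> = 4/3 * ((real q + 1) * ln (4 * a))" by (simp add: \<eta>a)
  finally have "(real q + 1) * ln (4 * a) \<le> 3/4 * (\<eta> * real s)" by linarith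
  moreover have "ln (3 * (real q + 1)) \<le> ln (4 * a)" using a by (subst ln_le_cancel_iff) auto
  moreover have "\<eta> * real q \<le> real q" using \<eta> by (simp add: mult_left_le_one_le)
  moreover have "(real q + 1) * ln (4 * a) = real q * ln (4 * a) + ln (4 * a)"
    by (simp add: algebra_simps)
  ultimately have "ln (3 * (real q + 1)) + real q * ln (real s) - \<eta> * (real s - real q) \<le> 0"
    using qln by (simp add: algebra_simps)
  then have "exp (ln (3 * (real q + 1)) + real q * ln (real s) - \<eta> * (real s - real q)) \<le> 1" by simp
  also have "exp (ln (3 * (real q + 1)) + real q * ln (real s) - \<eta> * (real s - real q))
      = 3 * (real q + 1) * (real s ^ q * exp (- \<eta> * (real s - real q)))"
    using sq by (simp add: exp_add exp_diff exp_minus exp_of_nat_mult field_simps)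
  finally have "(real q + 1) * (real s ^ q * exp (- \<eta> * (real s - real q))) \<le> 1/3"
    by (simp only: mult.assoc)
  moreover have "(\<Sum>j\<le>q. real s ^ j * (1 - \<eta>) ^ (s - j))
      \<le> (\<Sum>j\<le>q. real s ^ q * exp (- \<eta> * (real s - real q)))"
    using each by (intro sum_mono) auto
  ultimately show ?thesis by (simp add: add.commute)
qed

text \<open>The logarithm in the sample size is that of \<open>4 (q + 1) / \<eta>\<close>, and \<open>(q + 1) / \<eta>\<close> is at most its square,
  hence at most \<open>y\<close>. Stating the bound for all larger \<open>y\<close> allows further summands in the argument of
  \<open>soft\<close>.\<close>

lemma sample_size_soft_bound:
  fixes \<eta> y :: real
  assumes \<eta>: "0 < \<eta>" "\<eta> \<le> 1" and y: "(real q + 1)\<^sup>2 / \<eta>\<^sup>2 \<le> y"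
  shows "(real (sample_size q \<eta>))\<^sup>2 \<le> soft 81 2 y"
proof -
  define a where "a = (real q + 1) / \<eta>"
  define L where "L = log 2 (y + 2)"
  have a: "real q + 1 \<le> a" "1 \<le> a"
    using \<eta> mult_left_le_one_le[of "real q + 1" \<eta>] by (auto simp: a_def field_simps)
  have ay: "a\<^sup>2 \<le> y" using y by (simp add: a_def power_divide)
  then have y1: "1 \<le> y" using a one_le_power[of a 2] by linarith
  then have L1: "1 \<le> L" by (simp add: L_def)
  have "a \<le> a\<^sup>2" using a by (simp add: power2_eq_square)
  then have "log 2 a \<le> L" using a ay unfolding L_def by (subst log_le_cancel_iff) auto
  moreover have "ln a \<le> log 2 a"
    using a ln_2_less_1 by (simp add: log_def divide_simps mult_left_le)
  moreover have ln4a: "ln (4 * a) = ln 4 + ln a" using a by (simp add: ln_mult)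
  ultimately have lnL: "ln (4 * a) \<le> 3 * L" using ln_4_bounds L1 by linarith
  have "1 \<le> ln (4 * a)" using ln4a a ln_4_bounds ln_ge_zero[of a] by linarith
  then have aln: "1 * 1 \<le> a * ln (4 * a)" using a by (intro mult_mono) auto
  have "real (sample_size q \<eta>) \<le> 4/3 * a * ln (4 * a) + 1"
    unfolding sample_size_def a_def[symmetric] Let_def using aln by linarith
  also have "\<dots> \<le> 3 * a * ln (4 * a)" using aln by linarith
  also have "\<dots> \<le> 3 * a * (3 * L)" using lnL a by (intro mult_left_mono) auto
  finally have "(real (sample_size q \<eta>))\<^sup>2 \<le> (9 * a * L)\<^sup>2" by (intro power_mono) auto
  also have "\<dots> = 81 * a\<^sup>2 * L\<^sup>2" by (simp add: power_mult_distrib)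
  also have "\<dots> \<le> 81 * y * L\<^sup>2" using ay by (intro mult_right_mono) auto
  finally show ?thesis by (simp add: soft_def L_def)
qed

section \<open>From one-sided testers to containers\<close>

text \<open>The hereditary family read off from a canonical tester that samples \<open>m \<epsilon>\<close> vertices and decides by
  \<open>D \<epsilon>\<close>. Imposing the condition for all \<open>\<epsilon>\<close> at once makes the family independent of \<open>\<epsilon>\<close>; graphs with
  fewer than \<open>m \<epsilon>\<close> vertices are not constrained at \<open>\<epsilon>\<close>.\<close>

definition accepted_everywhere :: "(real \<Rightarrow> nat) \<Rightarrow> (real \<Rightarrow> graph \<Rightarrow> bool) \<Rightarrow> graph set" where
  "accepted_everywhere m D = {G. is_graph G \<and>
     (\<forall>\<epsilon>\<in>{0<..<1}. \<forall>U\<subseteq>verts G. card U = m \<epsilon> \<longrightarrow> D \<epsilon> (induced G U))}"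

lemma verts_induced [simp]: "verts (induced G U) = U"
  by (simp add: induced_def)

lemma induced_induced: "W \<subseteq> U \<Longrightarrow> induced (induced G U) W = induced G W"
  by (auto simp: induced_def)

lemma induced_verts: "is_graph G \<Longrightarrow> induced G (verts G) = G"
  by (cases G) (auto simp: induced_def is_graph_def)

lemma is_graph_induced: "is_graph G \<Longrightarrow> U \<subseteq> verts G \<Longrightarrow> is_graph (induced G U)"
  by (auto simp: induced_def is_graph_def intro: finite_subset)

lemma iso_induced_preimage:
  assumes h: "bij_betw h (verts G) (verts G')" "edges G' = (\<lambda>e. h ` e) ` edges G"
    and G: "is_graph G" and U': "U' \<subseteq> verts G'"
  defines "U \<equiv> {x \<in> verts G. h x \<in> U'}"
  shows "iso (induced G U) (induced G' U')" "card U = card U'"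
proof -
  have "h ` U = U'" using h(1) U' by (auto simp: U_def bij_betw_def)
  then have bij: "bij_betw h U U'"
    using h(1) by (auto simp: bij_betw_def U_def intro: inj_on_subset)
  have "h ` e \<subseteq> U' \<longleftrightarrow> e \<subseteq> U" if "e \<in> edges G" for e
    using that G by (auto simp: U_def is_graph_def)
  then have "edges (induced G' U') = (\<lambda>e. h ` e) ` edges (induced G U)"
    by (auto simp: induced_def h(2))
  then show "iso (induced G U) (induced G' U')" using bij by (auto simp: iso_def)
  show "card U = card U'" using bij by (rule bij_betw_same_card)
qed

text \<open>Subsets of an induced subgraph are subsets of the graph itself. Closure under isomorphism is
  inherited from the decision rule, applied to the preimage of each vertex set.\<close>

lemma hereditary_accepted_everywhere:
  assumes D: "\<And>\<epsilon>. \<epsilon> \<in> {0<..<1} \<Longrightarrow> iso_invariant (D \<epsilon>)"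
  shows "hereditary (accepted_everywhere m D)"
  unfolding hereditary_def graph_property_def
proof (intro conjI ballI allI impI)
  fix G G' assume G: "G \<in> accepted_everywhere m D" and G': "is_graph G'" and "iso G G'"
  then obtain h where h: "bij_betw h (verts G) (verts G')" "edges G' = (\<lambda>e. h ` e) ` edges G"
    by (auto simp: iso_def)
  have isG: "is_graph G" using G by (simp add: accepted_everywhere_def)
  have "D \<epsilon> (induced G' U')" if \<epsilon>: "\<epsilon> \<in> {0<..<1}" and U': "U' \<subseteq> verts G'" "card U' = m \<epsilon>" for \<epsilon> U'
  proof -
    let ?U = "{x \<in> verts G. h x \<in> U'}"
    have "D \<epsilon> (induced G ?U)"
      using G \<epsilon> U' iso_induced_preimage(2)[OF h isG U'(1)] by (auto simp: accepted_everywhere_def)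
    moreover have "is_graph (induced G ?U)" "is_graph (induced G' U')"
      using isG G' U' by (auto intro: is_graph_induced)
    ultimately show ?thesis
      using D[OF \<epsilon>] iso_induced_preimage(1)[OF h isG U'(1)] unfolding iso_invariant_def by blast
  qed
  then show "G' \<in> accepted_everywhere m D" using G' by (simp add: accepted_everywhere_def)
qed (auto simp: accepted_everywhere_def induced_induced intro: is_graph_induced)

text \<open>One-sided error means that no sample from a member of \<open>P\<close> is ever rejected, which is the inclusion
  of \<open>P\<close>. Conversely a graph in the family that is at least as large as the sample is never rejected,
  whereas a far graph would be.\<close>

lemma canonical_tester_witness:
  assumes P: "graph_property P" and T: "tester P T" "one_sided P T"
    and D: "\<And>\<epsilon>. \<epsilon> \<in> {0<..<1} \<Longrightarrow> iso_invariant (D \<epsilon>) \<and> T \<epsilon> = canonical_alg (m \<epsilon>) (D \<epsilon>)"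
  shows "semi_hereditary_witness P (accepted_everywhere m D) m"
  unfolding semi_hereditary_witness_def
proof (intro conjI ballI impI)
  show "hereditary (accepted_everywhere m D)" using D by (intro hereditary_accepted_everywhere) blast
  show "P \<subseteq> accepted_everywhere m D"
  proof
    fix G assume G: "G \<in> P"
    have isG: "is_graph G" using P G by (rule graph_property_is_graph)
    have "D \<epsilon> (induced G U)" if \<epsilon>: "\<epsilon> \<in> {0<..<1}" and U: "U \<subseteq> verts G" "card U = m \<epsilon>" for \<epsilon> U
    proof -
      have "accept_prob G (canonical_alg (m \<epsilon>) (D \<epsilon>)) = 1"
        using T(2)[unfolded one_sided_def, rule_format, OF \<epsilon> G] D[OF \<epsilon>] by simp
      moreover have "m \<epsilon> \<le> card (verts G)"
        using U isG card_mono[of "verts G" U] by (simp add: is_graph_def)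
      ultimately show ?thesis using U isG by (simp add: accept_prob_canonical_alg_eq_1_iff)
    qed
    then show "G \<in> accepted_everywhere m D" using isG by (simp add: accepted_everywhere_def)
  qed
next
  fix \<epsilon> :: real and G
  assume \<epsilon>: "\<epsilon> \<in> {0<..<1}" and G: "G \<in> accepted_everywhere m D" "m \<epsilon> \<le> card (verts G)"
  have isG: "is_graph G" using G by (simp add: accepted_everywhere_def)
  have none: "{S. S \<subseteq> verts G \<and> card S = m \<epsilon> \<and> \<not> D \<epsilon> (induced G S)} = {}"
    using G \<epsilon> by (auto simp: accepted_everywhere_def)
  have "reject_prob G (canonical_alg (m \<epsilon>) (D \<epsilon>)) = 0"
    unfolding reject_prob_canonical_alg_count[OF isG G(2)] none by simp
  then have "reject_prob G (T \<epsilon>) = 0" using D[OF \<epsilon>] by simp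
  moreover have "2/3 \<le> reject_prob G (T \<epsilon>)" if "far \<epsilon> G P"
    using T(1) \<epsilon> isG that unfolding tester_def by blast
  ultimately show "\<not> far \<epsilon> G P" by auto
qed

text \<open>The rejected sets of a far graph form a hypergraph of density at least \<open>2/3\<close> in which the sets that
  induce members of the family are independent. The fingerprint is ordered by listing it
  increasingly.\<close>

lemma canonical_tester_container:
  assumes P: "graph_property P" and T: "tester P T" "one_sided P T"
    and D: "\<And>\<epsilon>. \<epsilon> \<in> {0<..<1} \<Longrightarrow> iso_invariant (D \<epsilon>) \<and> T \<epsilon> = canonical_alg (m \<epsilon>) (D \<epsilon>)"
    and \<epsilon>: "\<epsilon> \<in> {0<..<1}"
  shows "ordered_container (accepted_everywhere m D) \<epsilon> (1 / (6 * real (max 1 (m \<epsilon>)))) (2 * m \<epsilon>) (m \<epsilon>)"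
  unfolding ordered_container_def
proof (intro conjI allI impI)
  fix G
  let ?H = "accepted_everywhere m D"
  let ?V = "verts G"
  assume isG: "is_graph G" and n: "2 * m \<epsilon> \<le> card ?V" and far: "far \<epsilon> G ?H"
  define F where "F = {S. S \<subseteq> ?V \<and> card S = m \<epsilon> \<and> \<not> D \<epsilon> (induced G S)}"
  have V: "finite ?V" using isG by (simp add: is_graph_def)
  have PH: "P \<subseteq> ?H"
    using canonical_tester_witness[OF P T D] by (simp add: semi_hereditary_witness_def)
  have "2/3 \<le> reject_prob G (T \<epsilon>)"
    using T(1) \<epsilon> isG far_antimono[OF far PH] unfolding tester_def by blast
  also have "\<dots> = real (card F) / real (card ?V choose m \<epsilon>)"
    using D[OF \<epsilon>] reject_prob_canonical_alg_count[OF isG, of "m \<epsilon>" "D \<epsilon>"] n by (simp add: F_def)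
  finally have dense: "2/3 * real (card ?V choose m \<epsilon>) \<le> real (card F)"
    using n by (simp add: field_simps zero_less_binomial_iff)
  have indep: "\<forall>S\<in>F. \<not> S \<subseteq> U" if U: "induced G U \<in> ?H" for U
  proof (intro ballI notI)
    fix S assume S: "S \<in> F" "S \<subseteq> U"
    then have "D \<epsilon> (induced (induced G U) S)"
      using U \<epsilon> unfolding accepted_everywhere_def F_def by auto
    then show False using S by (simp add: induced_induced F_def)
  qed
  show "\<exists>f C. \<forall>U\<subseteq>?V. induced G U \<in> ?H \<longrightarrow>
      distinct (f U) \<and> length (f U) \<le> m \<epsilon> \<and> set (f U) \<subseteq> U \<and> C (f U) \<subseteq> ?V \<and>
      real (card (C (f U))) \<le> (1 - 1 / (6 * real (max 1 (m \<epsilon>)))) * real (card ?V) \<and> U \<subseteq> C (f U)"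
  proof (cases "m \<epsilon> = 0")
    case True
    \<comment> \<open>Without samples the empty graph is rejected, so that no set induces a member of the family.\<close>
    then have "card F > 0" using dense by simp
    then obtain S where "S \<in> F" by (metis card_gt_0_iff ex_in_conv)
    moreover then have "S = {}" using True finite_subset[OF _ V, of S] by (auto simp: F_def)
    ultimately show ?thesis using indep by blast
  next
    case False
    then have max: "max 1 (m \<epsilon>) = m \<epsilon>" by simp
    have "F \<subseteq> {S. S \<subseteq> ?V \<and> card S = m \<epsilon>}" by (auto simp: F_def)
    then obtain C where C: "\<And>U. U \<subseteq> ?V \<Longrightarrow> \<forall>S\<in>F. \<not> S \<subseteq> U \<Longrightarrow> \<exists>T\<subseteq>U. card T \<le> m \<epsilon> \<and> U \<subseteq> C T \<and>
        C T \<subseteq> ?V \<and> real (card (C T)) \<le> (1 - 1 / (6 * real (m \<epsilon>))) * real (card ?V)"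
      using dense_hypergraph_container[OF V _ n _ dense] False by auto
    then have "\<forall>U. \<exists>T. U \<subseteq> ?V \<and> induced G U \<in> ?H \<longrightarrow> T \<subseteq> U \<and> card T \<le> m \<epsilon> \<and> U \<subseteq> C T \<and>
        C T \<subseteq> ?V \<and> real (card (C T)) \<le> (1 - 1 / (6 * real (m \<epsilon>))) * real (card ?V)"
      using indep by meson
    then obtain t where t: "\<And>U. U \<subseteq> ?V \<Longrightarrow> induced G U \<in> ?H \<Longrightarrow> t U \<subseteq> U \<and> card (t U) \<le> m \<epsilon> \<and>
        U \<subseteq> C (t U) \<and> C (t U) \<subseteq> ?V \<and>
        real (card (C (t U))) \<le> (1 - 1 / (6 * real (m \<epsilon>))) * real (card ?V)"
      by metis
    have fin: "finite (t U)" if "U \<subseteq> ?V" "induced G U \<in> ?H" for U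
      using t[OF that] that(1) V by (meson finite_subset)
    show ?thesis
      unfolding max
      using t fin by (intro exI[of _ "\<lambda>U. sorted_list_of_set (t U)"] exI[of _ "\<lambda>xs. C (set xs)"]) simp
  qed
qed (use \<epsilon> in auto)

section \<open>From containers to one-sided testers\<close>

lemma reject_prob_canonical_alg_eq_1:
  assumes "is_graph G"
    and "\<And>S. S \<subseteq> verts G \<Longrightarrow> card S = min m (card (verts G)) \<Longrightarrow> \<not> D (induced G S)"
  shows "reject_prob G (canonical_alg m D) = 1"
  using assms(2) by (auto simp: accept_prob_canonical_alg(2)[OF assms(1)] measure_pmf.prob_eq_1
      AE_measure_pmf_iff random_subset_support[OF assms(1)])

text \<open>The decision rule of the tester: fewer than \<open>s\<close> vertices in the sample mean that \<open>K\<close> is the whole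
  graph. With exactly \<open>s\<close> vertices it is unknown whether \<open>K\<close> is the whole graph, and membership in \<open>H\<close>
  is the right question either way.\<close>

definition small_or_hereditary :: "nat \<Rightarrow> graph set \<Rightarrow> graph set \<Rightarrow> graph \<Rightarrow> bool" where
  "small_or_hereditary s P H K \<longleftrightarrow> (if card (verts K) < s then K \<in> P else K \<in> H)"

text \<open>For \<open>\<eta> \<le> 1\<close> this is the union bound. For \<open>\<eta> > 1\<close> a container would have negative size as soon as there
  are vertices, so no set at all induces a member of \<open>H\<close>, whatever the sample size; a graph without vertices
  that has such a set is itself in \<open>H\<close>, hence not far from it.\<close>

lemma container_sampling:
  assumes H: "graph_property H" and cont: "ordered_container H \<epsilon> \<eta> N q"
    and G: "is_graph G" "N \<le> card (verts G)" "far \<epsilon> G H"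
    and s: "\<eta> \<le> 1 \<Longrightarrow> sample_size q \<eta> \<le> s"
  shows "real (card {S. S \<subseteq> verts G \<and> card S = s \<and> induced G S \<in> H})
    \<le> 1/3 * real (card (verts G) choose s)"
proof -
  let ?V = "verts G"
  let ?X = "{S. S \<subseteq> ?V \<and> card S = s \<and> induced G S \<in> H}"
  have V: "finite ?V" using G by (simp add: is_graph_def)
  obtain f C where fC: "\<And>U. U \<subseteq> ?V \<Longrightarrow> induced G U \<in> H \<Longrightarrow>
      distinct (f U) \<and> length (f U) \<le> q \<and> set (f U) \<subseteq> U \<and> C (f U) \<subseteq> ?V \<and>
      real (card (C (f U))) \<le> (1 - \<eta>) * real (card ?V) \<and> U \<subseteq> C (f U)"
    using cont G unfolding ordered_container_def by meson
  have pos: "0 < \<epsilon>" "0 < \<eta>" using cont by (auto simp: ordered_container_def)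
  show ?thesis
  proof (cases "\<eta> \<le> 1")
    case True
    have "real (card ?X) \<le> (\<Sum>j\<le>q. real s ^ j * (1 - \<eta>) ^ (s - j)) * real (card ?V choose s)"
      using V pos(2) True fC by (intro card_contained_sets_le[where f = f and C = C]) auto
    also have "\<dots> \<le> 1/3 * real (card ?V choose s)"
      using sample_size_suffices[OF pos(2) True s[OF True]] by (intro mult_right_mono) auto
    finally show ?thesis .
  next
    case False
    have "induced G S \<notin> H" if S: "S \<subseteq> ?V" for S
    proof
      assume SH: "induced G S \<in> H"
      then have "0 \<le> (1 - \<eta>) * real (card ?V)"
        using fC[OF S] by (meson of_nat_0_le_iff order_trans)
      then have "card ?V = 0" using False by (simp add: zero_le_mult_iff)
      then have "S = ?V" using V S by auto
      then have "G \<in> H" using SH G by (simp add: induced_verts)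
      then show False using not_far_self[OF H, of G \<epsilon>] G pos by simp
    qed
    then have "?X = {}" by auto
    then show ?thesis by (simp only: card.empty)
  qed
qed

text \<open>The error is one-sided because \<open>H\<close> is hereditary and contains \<open>P\<close>. The three lower bounds on the
  sample size serve, in this order, the passage from \<open>P\<close> to \<open>H\<close>, the existence of containers, and the
  union bound over fingerprints.\<close>

lemma one_sided_tester_of_containers:
  assumes P: "graph_property P" and W: "semi_hereditary_witness P H M"
    and cont: "\<And>\<epsilon>. \<epsilon> \<in> {0<..<1} \<Longrightarrow> ordered_container H \<epsilon> (\<eta> \<epsilon>) (N \<epsilon>) (q \<epsilon>)"
    and s: "\<And>\<epsilon>. M (\<epsilon>/2) \<le> s \<epsilon>" "\<And>\<epsilon>. N (\<epsilon>/2) \<le> s \<epsilon>"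
      "\<And>\<epsilon>. \<eta> (\<epsilon>/2) \<le> 1 \<Longrightarrow> sample_size (q (\<epsilon>/2)) (\<eta> (\<epsilon>/2)) \<le> s \<epsilon>"
  shows "has_one_sided_tester P (\<lambda>\<epsilon>. (s \<epsilon>)\<^sup>2)"
proof -
  define D where "D \<epsilon> = small_or_hereditary (s \<epsilon>) P H" for \<epsilon>
  define T where "T \<epsilon> = canonical_alg (s \<epsilon>) (D \<epsilon>)" for \<epsilon>
  have H: "hereditary H" "graph_property H" "P \<subseteq> H"
    using W by (auto simp: semi_hereditary_witness_def hereditary_def)
  have whole: "S = verts G" if "is_graph G" "S \<subseteq> verts G" "card S = card (verts G)" for S G
    using that by (simp add: is_graph_def card_subset_eq)
  have accept: "accept_prob G (T \<epsilon>) = 1" if G: "G \<in> P" for G \<epsilon>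
  proof -
    have isG: "is_graph G" using P G by (rule graph_property_is_graph)
    have "D \<epsilon> (induced G S)" if S: "S \<subseteq> verts G" "card S = min (s \<epsilon>) (card (verts G))" for S
    proof (cases "card S < s \<epsilon>")
      case True
      then have "S = verts G" using S isG by (intro whole) auto
      then show ?thesis using True G isG by (simp add: D_def small_or_hereditary_def induced_verts)
    next
      case False
      have "induced G S \<in> H" using H G S by (auto simp: hereditary_def)
      then show ?thesis using False by (simp add: D_def small_or_hereditary_def)
    qed
    then show ?thesis using isG by (simp add: T_def accept_prob_canonical_alg_eq_1_iff)
  qed
  have reject: "reject_prob G (T \<epsilon>) \<ge> 2/3"
    if \<epsilon>: "\<epsilon> \<in> {0<..<1}" and G: "is_graph G" "far \<epsilon> G P" for G \<epsilon>
  proof (cases "card (verts G) < s \<epsilon>")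
    case True
    have "G \<notin> P" using not_far_self[OF P, of G \<epsilon>] G \<epsilon> by auto
    then have "\<not> D \<epsilon> (induced G S)" if "S \<subseteq> verts G" "card S = min (s \<epsilon>) (card (verts G))" for S
      using whole[OF G(1) that(1)] that True G
      by (auto simp: D_def small_or_hereditary_def induced_verts)
    then show ?thesis using G by (simp add: T_def reject_prob_canonical_alg_eq_1)
  next
    case False
    let ?n = "card (verts G)"
    let ?A = "{S. S \<subseteq> verts G \<and> card S = s \<epsilon> \<and> induced G S \<in> H}"
    let ?R = "{S. S \<subseteq> verts G \<and> card S = s \<epsilon> \<and> \<not> D \<epsilon> (induced G S)}"
    have le: "M (\<epsilon>/2) \<le> ?n" "N (\<epsilon>/2) \<le> ?n" "s \<epsilon> \<le> ?n"
      using False s(1,2)[of \<epsilon>] by auto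
    have "far (\<epsilon>/2) G H" using far_from_hereditary_witness[OF P W G(1) \<epsilon> le(1) G(2)] .
    moreover have "ordered_container H (\<epsilon>/2) (\<eta> (\<epsilon>/2)) (N (\<epsilon>/2)) (q (\<epsilon>/2))"
      using cont[of "\<epsilon>/2"] \<epsilon> by simp
    ultimately have A: "real (card ?A) \<le> 1/3 * real (?n choose s \<epsilon>)"
      using s(3) G(1) le(2) by (intro container_sampling[OF H(2)])
    have V: "finite (verts G)" using G by (simp add: is_graph_def)
    have "{S. S \<subseteq> verts G \<and> card S = s \<epsilon>} = ?A \<union> ?R"
      by (auto simp: D_def small_or_hereditary_def)
    moreover have "card (?A \<union> ?R) = card ?A + card ?R"
      using V by (intro card_Un_disjoint) (auto simp: D_def small_or_hereditary_def)
    ultimately have "?n choose s \<epsilon> = card ?A + card ?R" using n_subsets[OF V, of "s \<epsilon>"] by simp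
    then have "2/3 * real (?n choose s \<epsilon>) \<le> real (card ?R)" using A by linarith
    then show ?thesis
      using le(3) reject_prob_canonical_alg_count[OF G(1) le(3), of "D \<epsilon>"]
      by (simp add: T_def pos_le_divide_eq zero_less_binomial_iff)
  qed
  have "queries_at_most (T \<epsilon>) ((s \<epsilon>)\<^sup>2)" "samples_at_most (T \<epsilon>) (s \<epsilon>)" for \<epsilon>
    by (simp_all add: T_def canonical_alg_complexity)
  then show ?thesis
    unfolding has_one_sided_tester_def tester_def one_sided_def
    using accept reject by (intro exI[of _ T]) auto
qed

theorem corollary1p7:
  shows
    "(\<forall>A>0. \<forall>\<gamma>\<in>{0<..1}. \<exists>c\<in>{0<..1}. \<exists>K>0. \<exists>\<kappa>>0.
        \<forall>(P :: graph set) (Q :: real \<Rightarrow> nat).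
          graph_property P \<longrightarrow> canonicalization_convention A \<gamma> P Q \<longrightarrow> has_one_sided_tester P Q \<longrightarrow>
          (\<exists>H M \<eta> N q. semi_hereditary_witness P H M \<and>
             (\<forall>\<epsilon>\<in>{0<..<1}.
                real (M \<epsilon>) \<le> K * real (Q (c * \<epsilon>)) \<and>
                ordered_container H \<epsilon> (\<eta> \<epsilon>) (N \<epsilon>) (q \<epsilon>) \<and>
                real (q \<epsilon>) \<le> K * real (Q (c * \<epsilon>)) \<and>
                \<eta> \<epsilon> \<ge> \<kappa> / real (max 1 (Q (c * \<epsilon>))) \<and>
                real (N \<epsilon>) \<le> K * real (Q (c * \<epsilon>)))))
     \<and>
     (\<exists>K>0. \<exists>k.
        \<forall>(P :: graph set) H (M :: real \<Rightarrow> nat) (\<eta> :: real \<Rightarrow> real) (N :: real \<Rightarrow> nat) (q :: real \<Rightarrow> nat).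
          graph_property P \<longrightarrow> semi_hereditary_witness P H M \<longrightarrow>
          (\<forall>\<epsilon>\<in>{0<..<1}. ordered_container H \<epsilon> (\<eta> \<epsilon>) (N \<epsilon>) (q \<epsilon>)) \<longrightarrow>
          (\<exists>Q'. has_one_sided_tester P Q' \<and>
             (\<forall>\<epsilon>\<in>{0<..<1}. real (Q' \<epsilon>) \<le>
                K * (real (M (\<epsilon>/2)))\<^sup>2 +
                soft K k ((real (N (\<epsilon>/2)))\<^sup>2 + (real (q (\<epsilon>/2)) + 1)\<^sup>2 / (\<eta> (\<epsilon>/2))\<^sup>2))))"
    (is "?containers \<and> ?testers")
proof
  have containers: "\<exists>H M \<eta> N q. semi_hereditary_witness P H M \<and>
      (\<forall>\<epsilon>\<in>{0<..<1}. real (M \<epsilon>) \<le> 2 * A * real (Q (\<gamma> * \<epsilon>)) \<and>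
         ordered_container H \<epsilon> (\<eta> \<epsilon>) (N \<epsilon>) (q \<epsilon>) \<and> real (q \<epsilon>) \<le> 2 * A * real (Q (\<gamma> * \<epsilon>)) \<and>
         \<eta> \<epsilon> \<ge> 1 / (6 * max 1 A) / real (max 1 (Q (\<gamma> * \<epsilon>))) \<and>
         real (N \<epsilon>) \<le> 2 * A * real (Q (\<gamma> * \<epsilon>)))"
    if A: "A > 0" and P: "graph_property P" and conv: "canonicalization_convention A \<gamma> P Q"
      and tst: "has_one_sided_tester P Q" for A \<gamma> :: real and P Q
  proof -
    obtain T m where T: "tester P T" "one_sided P T" "canonical T m"
      and m: "\<And>\<epsilon>. \<epsilon> \<in> {0<..<1} \<Longrightarrow> real (m \<epsilon>) \<le> A * real (Q (\<gamma> * \<epsilon>))"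
      using conv tst unfolding canonicalization_convention_def by blast
    obtain D where D: "\<And>\<epsilon>. \<epsilon> \<in> {0<..<1} \<Longrightarrow> iso_invariant (D \<epsilon>) \<and> T \<epsilon> = canonical_alg (m \<epsilon>) (D \<epsilon>)"
      using T(3) unfolding canonical_def by metis
    have \<eta>: "1 / (6 * real (max 1 (m \<epsilon>))) \<ge> 1 / (6 * max 1 A) / real (max 1 (Q (\<gamma> * \<epsilon>)))"
      if \<epsilon>: "\<epsilon> \<in> {0<..<1}" for \<epsilon>
    proof -
      let ?Q = "Q (\<gamma> * \<epsilon>)"
      have "1 * 1 \<le> max 1 A * real (max 1 ?Q)" by (intro mult_mono) auto
      moreover have "A * real ?Q \<le> max 1 A * real (max 1 ?Q)" by (intro mult_mono) auto
      ultimately have "real (max 1 (m \<epsilon>)) \<le> max 1 A * real (max 1 ?Q)"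
        using m[OF \<epsilon>] by simp
      then have "1 / (6 * (max 1 A * real (max 1 ?Q))) \<le> 1 / (6 * real (max 1 (m \<epsilon>)))"
        by (intro divide_left_mono) (auto intro!: mult_pos_pos)
      then show ?thesis by (simp add: mult.assoc)
    qed
    show ?thesis
    proof (intro exI conjI ballI)
      show "semi_hereditary_witness P (accepted_everywhere m D) m"
        using canonical_tester_witness[OF P T(1,2) D] .
      fix \<epsilon> :: real assume \<epsilon>: "\<epsilon> \<in> {0<..<1}"
      show "ordered_container (accepted_everywhere m D) \<epsilon> (1 / (6 * real (max 1 (m \<epsilon>)))) (2 * m \<epsilon>) (m \<epsilon>)"
        using canonical_tester_container[OF P T(1,2) D \<epsilon>] .
      have "0 \<le> A * real (Q (\<gamma> * \<epsilon>))" using A by simp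
      then show "real (m \<epsilon>) \<le> 2 * A * real (Q (\<gamma> * \<epsilon>))" "real (m \<epsilon>) \<le> 2 * A * real (Q (\<gamma> * \<epsilon>))"
        "real (2 * m \<epsilon>) \<le> 2 * A * real (Q (\<gamma> * \<epsilon>))"
        using m[OF \<epsilon>] by auto
    qed (rule \<eta>)
  qed
  show ?containers
  proof (intro allI impI ballI, goal_cases)
    case (1 A \<gamma>)
    then have "2 * A > 0" "1 / (6 * max 1 A) > 0" by auto
    with 1 show ?case using containers[OF 1(1)] by blast
  qed
next
  have "\<exists>Q'. has_one_sided_tester P Q' \<and> (\<forall>\<epsilon>\<in>{0<..<1}. real (Q' \<epsilon>) \<le>
      82 * (real (M (\<epsilon>/2)))\<^sup>2 +
      soft 82 2 ((real (N (\<epsilon>/2)))\<^sup>2 + (real (q (\<epsilon>/2)) + 1)\<^sup>2 / (\<eta> (\<epsilon>/2))\<^sup>2))"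
    if P: "graph_property P" and W: "semi_hereditary_witness P H M"
      and cont: "\<forall>\<epsilon>\<in>{0<..<1}. ordered_container H \<epsilon> (\<eta> \<epsilon>) (N \<epsilon>) (q \<epsilon>)" for P H M \<eta> N q
  proof -
    \<comment> \<open>The size \<open>0\<close> for \<open>\<eta> > 1\<close> matters: the argument of \<open>soft\<close> can then be arbitrarily small.\<close>
    define r where "r \<epsilon> = (if \<eta> (\<epsilon>/2) \<le> 1 then sample_size (q (\<epsilon>/2)) (\<eta> (\<epsilon>/2)) else 0)" for \<epsilon>
    define s where "s \<epsilon> = max (max (M (\<epsilon>/2)) (N (\<epsilon>/2))) (r \<epsilon>)" for \<epsilon>
    have "has_one_sided_tester P (\<lambda>\<epsilon>. (s \<epsilon>)\<^sup>2)"
      using cont by (intro one_sided_tester_of_containers[OF P W]) (auto simp: s_def r_def)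
    moreover have "real ((s \<epsilon>)\<^sup>2) \<le> 82 * (real (M (\<epsilon>/2)))\<^sup>2 +
        soft 82 2 ((real (N (\<epsilon>/2)))\<^sup>2 + (real (q (\<epsilon>/2)) + 1)\<^sup>2 / (\<eta> (\<epsilon>/2))\<^sup>2)"
      if \<epsilon>: "\<epsilon> \<in> {0<..<1}" for \<epsilon>
    proof -
      define x where "x = (real (N (\<epsilon>/2)))\<^sup>2 + (real (q (\<epsilon>/2)) + 1)\<^sup>2 / (\<eta> (\<epsilon>/2))\<^sup>2"
      have x: "(real (N (\<epsilon>/2)))\<^sup>2 \<le> x" "(real (q (\<epsilon>/2)) + 1)\<^sup>2 / (\<eta> (\<epsilon>/2))\<^sup>2 \<le> x" "0 \<le> x"
        by (auto simp: x_def)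
      have "0 < \<eta> (\<epsilon>/2)"
        using cont[rule_format, of "\<epsilon>/2"] \<epsilon> by (simp add: ordered_container_def)
      moreover have "0 \<le> soft 81 2 x" using x by (simp add: soft_def)
      ultimately have r: "(real (r \<epsilon>))\<^sup>2 \<le> soft 81 2 x"
        using sample_size_soft_bound x(2) by (simp add: r_def)
      have "1 \<le> log 2 (x + 2)" using x(3) by simp
      then have "x * 1 \<le> x * (log 2 (x + 2))\<^sup>2" using x(3) by (intro mult_left_mono one_le_power)
      then have "(real (N (\<epsilon>/2)))\<^sup>2 \<le> soft 1 2 x" using x(1) by (simp add: soft_def)
      moreover have "soft 1 2 x + soft 81 2 x = soft 82 2 x" by (simp add: soft_def)
      moreover have "(real (s \<epsilon>))\<^sup>2 \<le> (real (M (\<epsilon>/2)))\<^sup>2 + (real (N (\<epsilon>/2)))\<^sup>2 + (real (r \<epsilon>))\<^sup>2"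
        by (auto simp: s_def max_def)
      moreover have "0 \<le> (real (M (\<epsilon>/2)))\<^sup>2" by simp
      ultimately have "(real (s \<epsilon>))\<^sup>2 \<le> 82 * (real (M (\<epsilon>/2)))\<^sup>2 + soft 82 2 x" using r by linarith
      then show ?thesis by (simp add: x_def)
    qed
    ultimately show ?thesis by blast
  qed
  then show ?testers by (intro exI[of _ 82] conjI exI[of _ 2]) auto
qed

end
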